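(* Non-termination is decidable for branch-effective branch-WSTS: given a branch-effective branch-WSTS $\mathcal{S}=(X,\Sigma,\to,\leq,x_0)$, it is decidable whether there is an infinite sequence of states $x_1,x_2,\ldots$ with $x_0\to x_1\to x_2\to\cdots$.
   Context: A quasi-ordered labelled transition system (OLTS) is a tuple $\mathcal{S}=(X,\Sigma,\to,\leq,x_0)$ where $X$ is a set of states, $\Sigma$ a finite alphabet, ${\to}\subseteq X\times\Sigma\times X$ a transition relation (written $x\xrightarrow{a}x'$), $\leq$ a quasi-ordering on $X$ and $x_0\in X$ the initial state. $x\xrightarrow{\sigma}x'$ for $\sigma\in\Sigma^*$ is defined as usual; $x\to x'$ means $x\xrightarrow{a}x'$ for some $a$. $\mathrm{Post}(x)=\{y\mid x\to y\}$. A run is a finite or infinite sequence $x_0\to x_1\to\cdots$. The OLTS is: finitely branching if $\mathrm{Post}(x)$ is finite for all $x$; branch-wqo if for every run the set of states visited along it is well-quasi-ordered by $\leq$; branch-monotone if for all $x,x'\in X$, $\sigma\in\Sigma^*$ with $x\xrightarrow{\sigma}x'$ and $x\leq x'$ there is $y$ with $x'\xrightarrow{\sigma}y$ and $x'\leq y$. A branch-WSTS is a finitely branching, branch-monotone, branch-wqo OLTS. It is branch-effective if $\leq$ and each $\xrightarrow{a}$ are decidable and $\mathrm{Post}(x)$ is a computable finite set for all $x$. *)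

theory Defs
  imports Main "HOL-Library.Nat_Bijection"
begin

section \<open>Partial recursive functions\<close>

text \<open>
  Kleene's partial recursive functions in their unary presentation: several arguments are
  packed into one by the bijection \<^const>\<open>prod_encode\<close>, so projections and pairing replace
  the usual families of n-ary projections and compositions. In \<open>PRec f g\<close> the argument is
  the pair of the parameter and the recursion variable; \<open>Mu f\<close> is unbounded minimisation,
  which diverges as soon as \<open>f\<close> diverges before reaching its first zero.
\<close>

datatype prog =
    Zero
  | Succ
  | Fst
  | Snd
  | Pair prog prog
  | Comp prog prog
  | PRec prog prog
  | Mu prog

text \<open>\<open>evals p n m\<close>: on input \<open>n\<close> the program \<open>p\<close> halts with output \<open>m\<close>.\<close>

inductive evals :: "prog \<Rightarrow> nat \<Rightarrow> nat \<Rightarrow> bool" where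
  evals_Zero: "evals Zero n 0"
| evals_Succ: "evals Succ n (Suc n)"
| evals_Fst: "evals Fst (prod_encode (m, n)) m"
| evals_Snd: "evals Snd (prod_encode (m, n)) n"
| evals_Pair: "evals f n k \<Longrightarrow> evals g n l \<Longrightarrow> evals (Pair f g) n (prod_encode (k, l))"
| evals_Comp: "evals g n k \<Longrightarrow> evals f k l \<Longrightarrow> evals (Comp f g) n l"
| evals_PRec_0: "evals f a k \<Longrightarrow> evals (PRec f g) (prod_encode (a, 0)) k"
| evals_PRec_Suc:
    "evals (PRec f g) (prod_encode (a, n)) k \<Longrightarrow>
     evals g (prod_encode (a, prod_encode (n, k))) l \<Longrightarrow>
     evals (PRec f g) (prod_encode (a, Suc n)) l"
| evals_Mu:
    "evals f (prod_encode (a, n)) 0 \<Longrightarrow>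
     (\<And>m. m < n \<Longrightarrow> \<exists>k. evals f (prod_encode (a, m)) (Suc k)) \<Longrightarrow>
     evals (Mu f) a n"

lemma evals_deterministic: "evals p n k \<Longrightarrow> evals p n l \<Longrightarrow> k = l"
proof (induction p n k arbitrary: l rule: evals.induct)
  case (evals_Zero n)
  then show ?case by cases auto
next
  case (evals_Succ n)
  then show ?case by cases auto
next
  case (evals_Fst m n)
  then show ?case by cases auto
next
  case (evals_Snd m n)
  then show ?case by cases auto
next
  case (evals_Pair f n k g l' r)
  from evals_Pair.prems evals_Pair.IH show ?case by cases auto
next
  case (evals_Comp g n k f l' r)
  from evals_Comp.prems show ?case
  proof cases
    case (evals_Comp k')
    with evals_Comp.IH show ?thesis by blast
  qed
next
  case (evals_PRec_0 f a k g)
  from evals_PRec_0.prems evals_PRec_0.IH show ?case by cases auto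
next
  case (evals_PRec_Suc f g a n k l' r)
  from evals_PRec_Suc.prems show ?case
  proof cases
    case (evals_PRec_Suc a' n' k')
    with evals_PRec_Suc.IH show ?thesis by auto
  qed auto
next
  case (evals_Mu f a n r)
  from evals_Mu.prems show ?case
  proof cases
    case evals_Mu': evals_Mu
    show ?thesis
    proof (rule linorder_cases)
      assume "n < r"
      then show ?thesis using evals_Mu'(2) evals_Mu.IH(1) by fastforce
    next
      assume "r < n"
      then show ?thesis using evals_Mu'(1) evals_Mu.IH(2) by fastforce
    qed
  qed
qed

fun prog_code :: "prog \<Rightarrow> nat" where
  "prog_code Zero = prod_encode (0, 0)"
| "prog_code Succ = prod_encode (1, 0)"
| "prog_code Fst = prod_encode (2, 0)"
| "prog_code Snd = prod_encode (3, 0)"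
| "prog_code (Pair f g) = prod_encode (4, prod_encode (prog_code f, prog_code g))"
| "prog_code (Comp f g) = prod_encode (5, prod_encode (prog_code f, prog_code g))"
| "prog_code (PRec f g) = prod_encode (6, prod_encode (prog_code f, prog_code g))"
| "prog_code (Mu f) = prod_encode (7, prog_code f)"

lemma inj_prog_code: "inj prog_code"
proof (rule injI)
  show "prog_code p = prog_code q \<Longrightarrow> p = q" for p q
    by (induction p arbitrary: q) (case_tac q; simp)+
qed


section \<open>Quasi-ordered labelled transition systems\<close>

record ('x, 'a) olts =
  states :: "'x set"
  alphabet :: "'a set"
  transitions :: "('x \<times> 'a \<times> 'x) set"
  qorder :: "('x \<times> 'x) set"
  initial :: "'x"

definition is_olts :: "('x, 'a) olts \<Rightarrow> bool" where
  "is_olts S \<longleftrightarrow>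
     finite (alphabet S) \<and>
     transitions S \<subseteq> states S \<times> alphabet S \<times> states S \<and>
     preorder_on (states S) (qorder S) \<and>
     initial S \<in> states S"

definition step :: "('x, 'a) olts \<Rightarrow> 'x \<Rightarrow> 'x \<Rightarrow> bool" where
  "step S x y \<longleftrightarrow> (\<exists>a. (x, a, y) \<in> transitions S)"

fun word_step :: "('x, 'a) olts \<Rightarrow> 'x \<Rightarrow> 'a list \<Rightarrow> 'x \<Rightarrow> bool" where
  "word_step S x [] y \<longleftrightarrow> x = y"
| "word_step S x (a # w) y \<longleftrightarrow> (\<exists>z. (x, a, z) \<in> transitions S \<and> word_step S z w y)"

definition Post :: "('x, 'a) olts \<Rightarrow> 'x \<Rightarrow> 'x set" where
  "Post S x = {y. step S x y}"

definition finite_run :: "('x, 'a) olts \<Rightarrow> 'x list \<Rightarrow> bool" where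
  "finite_run S xs \<longleftrightarrow>
     xs \<noteq> [] \<and> hd xs = initial S \<and> (\<forall>i. Suc i < length xs \<longrightarrow> step S (xs ! i) (xs ! Suc i))"

definition infinite_run :: "('x, 'a) olts \<Rightarrow> (nat \<Rightarrow> 'x) \<Rightarrow> bool" where
  "infinite_run S f \<longleftrightarrow> f 0 = initial S \<and> (\<forall>i. step S (f i) (f (Suc i)))"

definition wqo_on :: "'x set \<Rightarrow> ('x \<times> 'x) set \<Rightarrow> bool" where
  "wqo_on A r \<longleftrightarrow> (\<forall>f :: nat \<Rightarrow> 'x. range f \<subseteq> A \<longrightarrow> (\<exists>i j. i < j \<and> (f i, f j) \<in> r))"

definition finitely_branching :: "('x, 'a) olts \<Rightarrow> bool" where
  "finitely_branching S \<longleftrightarrow> (\<forall>x \<in> states S. finite (Post S x))"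

definition branch_wqo :: "('x, 'a) olts \<Rightarrow> bool" where
  "branch_wqo S \<longleftrightarrow>
     (\<forall>xs. finite_run S xs \<longrightarrow> wqo_on (set xs) (qorder S)) \<and>
     (\<forall>f. infinite_run S f \<longrightarrow> wqo_on (range f) (qorder S))"

definition branch_monotone :: "('x, 'a) olts \<Rightarrow> bool" where
  "branch_monotone S \<longleftrightarrow>
     (\<forall>x \<in> states S. \<forall>x' \<in> states S. \<forall>w \<in> lists (alphabet S).
        word_step S x w x' \<and> (x, x') \<in> qorder S \<longrightarrow>
        (\<exists>y. word_step S x' w y \<and> (x', y) \<in> qorder S))"

definition branch_wsts :: "('x, 'a) olts \<Rightarrow> bool" where
  "branch_wsts S \<longleftrightarrow>
     is_olts S \<and> finitely_branching S \<and> branch_monotone S \<and> branch_wqo S"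

definition non_terminating :: "('x, 'a) olts \<Rightarrow> bool" where
  "non_terminating S \<longleftrightarrow> (\<exists>f. infinite_run S f)"


section \<open>Effectiveness\<close>

text \<open>
  States are handed to programs through an injective numbering \<open>enc\<close> of the state set. The
  programs below must halt with the correct answer on (numbers of) states; on other inputs
  their behaviour is arbitrary, so that the range of the numbering need not be decidable.
\<close>

definition decides_rel :: "('x \<Rightarrow> nat) \<Rightarrow> 'x set \<Rightarrow> ('x \<times> 'x) set \<Rightarrow> prog \<Rightarrow> bool" where
  "decides_rel enc X r p \<longleftrightarrow>
     (\<forall>x \<in> X. \<forall>y \<in> X. evals p (prod_encode (enc x, enc y)) (if (x, y) \<in> r then 1 else 0))"

definition computes_Post :: "('x \<Rightarrow> nat) \<Rightarrow> ('x, 'a) olts \<Rightarrow> prog \<Rightarrow> bool" where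
  "computes_Post enc S p \<longleftrightarrow>
     (\<forall>x \<in> states S. \<exists>ys. set ys = Post S x \<and> evals p (enc x) (list_encode (map enc ys)))"

text \<open>
  \<open>effective_description S n\<close>: the number \<open>n\<close> is a finite description of \<open>S\<close>. It consists of a
  program deciding the ordering, one program for each letter \<open>a\<close> (in some enumeration of the
  alphabet) deciding the one-step relation labelled \<open>a\<close>, a program computing \<^const>\<open>Post\<close>, and
  the number of the initial state.
\<close>

definition effective_description :: "('x, 'a) olts \<Rightarrow> nat \<Rightarrow> bool" where
  "effective_description S n \<longleftrightarrow>
     (\<exists>enc letters ord_prog trans_progs post_prog.
        inj_on enc (states S) \<and>
        distinct letters \<and> set letters = alphabet S \<and>
        decides_rel enc (states S) (qorder S) ord_prog \<and>
        list_all2 (\<lambda>a p. decides_rel enc (states S) {(x, y). (x, a, y) \<in> transitions S} p)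
          letters trans_progs \<and>
        computes_Post enc S post_prog \<and>
        n = prod_encode (prog_code ord_prog,
              prod_encode (list_encode (map prog_code trans_progs),
                prod_encode (prog_code post_prog, enc (initial S)))))"

definition branch_effective :: "('x, 'a) olts \<Rightarrow> bool" where
  "branch_effective S \<longleftrightarrow> (\<exists>n. effective_description S n)"

text \<open>
  A single program decides the property \<open>Q\<close> of all systems in the class \<open>C\<close>, uniformly in
  their effective descriptions. (For one fixed system, deciding \<open>Q\<close> would be trivial: one of
  the two constant programs does it.) As the states of an effective system are numbered, the
  case where both type variables are \<^typ>\<open>nat\<close> covers all systems up to isomorphism.
\<close>

definition uniformly_decidable ::
  "(('x, 'a) olts \<Rightarrow> bool) \<Rightarrow> (('x, 'a) olts \<Rightarrow> bool) \<Rightarrow> bool" where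
  "uniformly_decidable C Q \<longleftrightarrow>
     (\<exists>p. \<forall>S n. C S \<and> effective_description S n \<longrightarrow> evals p n (if Q S then 1 else 0))"

end

theory Submission
  imports Defs
begin

text \<open>
  Both non-termination and termination are semidecidable, uniformly in the description. A
  branch-WSTS has an infinite run iff it has a finite run containing states \<open>x\<^sub>i \<le> x\<^sub>j\<close> with
  \<open>i < j\<close>: one direction is branch-wqo, and by branch-monotonicity the word leading from \<open>x\<^sub>i\<close>
  to \<open>x\<^sub>j\<close> can be iterated for ever. It terminates iff its tree of runs is well-founded, which by
  finite branching is witnessed by a finite derivation. Checking either kind of witness means
  running the programs in the description; this is possible because \<open>evals\<close>, read on program
  codes, is itself given by finite derivations. A single minimisation then searches for a witness
  of either kind.
\<close>

section \<open>Computable functions and semidecidable predicates\<close>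

definition nfst :: "nat \<Rightarrow> nat" where "nfst z = fst (prod_decode z)"
definition nsnd :: "nat \<Rightarrow> nat" where "nsnd z = snd (prod_decode z)"

lemma nfst_encode [simp]: "nfst (prod_encode (a, b)) = a"
  and nsnd_encode [simp]: "nsnd (prod_encode (a, b)) = b"
  by (simp_all add: nfst_def nsnd_def)

lemma encode_nfst_nsnd: "prod_encode (nfst z, nsnd z) = z"
  by (simp add: nfst_def nsnd_def)

definition computable :: "(nat \<Rightarrow> nat) \<Rightarrow> bool" where
  "computable f \<longleftrightarrow> (\<exists>p. \<forall>n. evals p n (f n))"

lemma computableI: "(\<And>n. evals p n (f n)) \<Longrightarrow> computable f"
  unfolding computable_def by blast

lemma evals_nfst: "evals Fst n (nfst n)"
  by (metis evals_Fst encode_nfst_nsnd)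

lemma evals_nsnd: "evals Snd n (nsnd n)"
  by (metis evals_Snd encode_nfst_nsnd)

lemma evals_id: "evals (Pair Fst Snd) n n"
  by (metis evals_Pair evals_nfst evals_nsnd encode_nfst_nsnd)

lemma computable_id: "computable (\<lambda>x. x)"
  by (rule computableI) (rule evals_id)

lemma computable_comp: "computable f \<Longrightarrow> computable g \<Longrightarrow> computable (\<lambda>x. f (g x))"
  unfolding computable_def by (blast intro: evals_Comp)

lemma computable_Suc: "computable f \<Longrightarrow> computable (\<lambda>x. Suc (f x))"
  by (rule computable_comp[where f = Suc]) (auto intro: computableI evals_Succ)

lemma computable_nfst: "computable f \<Longrightarrow> computable (\<lambda>x. nfst (f x))"
  by (rule computable_comp[where f = nfst]) (auto intro: computableI evals_nfst)

lemma computable_nsnd: "computable f \<Longrightarrow> computable (\<lambda>x. nsnd (f x))"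
  by (rule computable_comp[where f = nsnd]) (auto intro: computableI evals_nsnd)

lemma computable_encode:
  "computable f \<Longrightarrow> computable g \<Longrightarrow> computable (\<lambda>x. prod_encode (f x, g x))"
  unfolding computable_def by (blast intro: evals_Pair)

lemma computable_const: "computable (\<lambda>x. c)"
proof (induction c)
  case 0
  show ?case by (rule computableI) (rule evals_Zero)
next
  case (Suc c)
  then show ?case by (rule computable_Suc)
qed

text \<open>\<open>PRec\<close> hands its parameter on to the step program, so running it on the
  pair of \<open>x\<close> and \<open>h x\<close> lets every part depend on \<open>x\<close>. The
  premise on \<open>g\<close> follows the argument layout of \<open>PRec\<close>.\<close>

lemma computable_rec:
  assumes f: "computable f"
    and g: "computable (\<lambda>z. g (nfst z) (nfst (nsnd z)) (nsnd (nsnd z)))"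
    and h: "computable h"
  shows "computable (\<lambda>x. rec_nat (f x) (g x) (h x))"
proof -
  obtain pf pg ph where pf: "\<And>n. evals pf n (f n)" and ph: "\<And>n. evals ph n (h n)"
    and pg: "\<And>z. evals pg z (g (nfst z) (nfst (nsnd z)) (nsnd (nsnd z)))"
    using assms unfolding computable_def by blast
  have "evals (PRec pf pg) (prod_encode (x, n)) (rec_nat (f x) (g x) n)" for x n
  proof (induction n)
    case 0
    show ?case using evals_PRec_0[OF pf] by simp
  next
    case (Suc n)
    have "evals pg (prod_encode (x, prod_encode (n, rec_nat (f x) (g x) n)))
        (g x n (rec_nat (f x) (g x) n))"
      using pg[of "prod_encode (x, prod_encode (n, rec_nat (f x) (g x) n))"] by simp
    from evals_PRec_Suc[OF Suc this] show ?case by simp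
  qed
  then have "evals (Comp (PRec pf pg) (Pair (Pair Fst Snd) ph)) x (rec_nat (f x) (g x) (h x))" for x
    by (blast intro: evals_Comp evals_Pair evals_id ph)
  then show ?thesis by (rule computableI)
qed

lemmas computable_intros = computable_const computable_id computable_Suc computable_nfst
  computable_nsnd computable_encode

text \<open>Truncated subtraction is iterated predecessor, and the predecessor is a recursion
  returning its recursion variable.\<close>

lemma computable_diff:
  assumes "computable f" "computable g"
  shows "computable (\<lambda>x. f x - g x)"
proof -
  have pred: "rec_nat 0 (\<lambda>n r. n) m = m - 1" for m :: nat
    by (cases m) simp_all
  have "computable (\<lambda>x. rec_nat (f x) (\<lambda>n r. rec_nat 0 (\<lambda>n r. n) r) (g x))"
    by (intro computable_rec computable_intros assms)
  moreover have "rec_nat a (\<lambda>n r. rec_nat 0 (\<lambda>n r. n) r) b = a - b" for a b :: nat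
    by (induction b) (simp_all add: pred)
  ultimately show ?thesis by simp
qed

section \<open>Decidable predicates\<close>

text \<open>Truth is coded by \<open>0\<close>, unlike in \<open>decides_rel\<close>: minimisation
  then stops at the first witness, and recursion on the value acts as case distinction.\<close>

definition decidable :: "(nat \<Rightarrow> bool) \<Rightarrow> bool" where
  "decidable P \<longleftrightarrow> computable (\<lambda>x. if P x then 0 else 1)"

lemma decidable_comp: "decidable P \<Longrightarrow> computable f \<Longrightarrow> decidable (\<lambda>x. P (f x))"
  unfolding decidable_def by (rule computable_comp)

lemma computable_if:
  assumes "decidable P" "computable f" "computable g"
  shows "computable (\<lambda>x. if P x then f x else g x)"
proof -
  have "computable (\<lambda>x. rec_nat (f x) (\<lambda>n r. g x) (if P x then 0 else 1))"
    by (intro computable_rec computable_intros assms(1)[unfolded decidable_def] assms(2)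
        computable_comp[OF assms(3)])
  then show ?thesis by (rule back_subst[of computable]) auto
qed

lemma decidable_not:
  assumes "decidable P"
  shows "decidable (\<lambda>x. \<not> P x)"
proof -
  have "computable (\<lambda>x. if P x then 1 else 0)"
    by (intro computable_if assms computable_const)
  then show ?thesis
    unfolding decidable_def by (rule back_subst[of computable]) auto
qed

lemma decidable_conj:
  assumes "decidable P" "decidable Q"
  shows "decidable (\<lambda>x. P x \<and> Q x)"
proof -
  have "computable (\<lambda>x. if P x then if Q x then 0 else 1 else 1)"
    by (intro computable_if assms computable_const)
  then show ?thesis
    unfolding decidable_def by (rule back_subst[of computable]) auto
qed

lemma decidable_disj: "decidable P \<Longrightarrow> decidable Q \<Longrightarrow> decidable (\<lambda>x. P x \<or> Q x)"
  using decidable_not[OF decidable_conj[OF decidable_not decidable_not]] by simp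

lemma decidable_le:
  assumes "computable f" "computable g"
  shows "decidable (\<lambda>x. f x \<le> g x)"
proof -
  have "computable (\<lambda>x. rec_nat 0 (\<lambda>n r. 1) (f x - g x))"
    by (intro computable_rec computable_intros computable_diff assms)
  moreover have "rec_nat 0 (\<lambda>n r. 1) (a - b) = (if a \<le> b then 0 else 1 :: nat)" for a b :: nat
    by (cases "a - b") auto
  ultimately show ?thesis by (simp add: decidable_def)
qed

lemma decidable_less: "computable f \<Longrightarrow> computable g \<Longrightarrow> decidable (\<lambda>x. f x < g x)"
  using decidable_le[OF computable_Suc] by (simp add: Suc_le_eq)

lemma decidable_eq: "computable f \<Longrightarrow> computable g \<Longrightarrow> decidable (\<lambda>x. f x = g x)"
  using decidable_conj[OF decidable_le decidable_le] by (simp add: eq_iff)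

text \<open>Search by primitive recursion: the accumulator starts at \<open>1\<close> (false),
  becomes \<open>0\<close> (true) at a witness and then stays \<open>0\<close>.\<close>

lemma decidable_bex:
  assumes P: "decidable (\<lambda>z. P (nfst z) (nsnd z))" and f: "computable f"
  shows "decidable (\<lambda>x. \<exists>m<f x. P x m)"
proof -
  have "decidable (\<lambda>z. P (nfst z) (nfst (nsnd z)))"
    using decidable_comp[OF P, of "\<lambda>z. prod_encode (nfst z, nfst (nsnd z))"]
    by (simp add: computable_intros)
  then have "computable (\<lambda>x. rec_nat 1 (\<lambda>m r. if P x m then 0 else r) (f x))"
    by (intro computable_rec computable_intros computable_if f)
  moreover have "rec_nat 1 (\<lambda>m r. if P x m then 0 else r) k = (if \<exists>m<k. P x m then 0 else 1 :: nat)"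
    for x k
    by (induction k) (auto simp: less_Suc_eq)
  ultimately show ?thesis by (simp add: decidable_def)
qed

lemma decidable_ball:
  assumes "decidable (\<lambda>z. P (nfst z) (nsnd z))" "computable f"
  shows "decidable (\<lambda>x. \<forall>m<f x. P x m)"
  using decidable_not[OF decidable_bex[OF decidable_not[OF assms(1)] assms(2)]] by simp

section \<open>Semidecidable predicates\<close>

text \<open>This projection form of recursive enumerability involves total functions only, so
  closure properties reduce to repacking witnesses.\<close>

definition semidecidable :: "(nat \<Rightarrow> bool) \<Rightarrow> bool" where
  "semidecidable P \<longleftrightarrow>
    (\<exists>Q. decidable (\<lambda>z. Q (nfst z) (nsnd z)) \<and> (\<forall>x. P x \<longleftrightarrow> (\<exists>s. Q x s)))"

lemma semidecidableI:
  "decidable (\<lambda>z. Q (nfst z) (nsnd z)) \<Longrightarrow> (\<And>x. P x \<longleftrightarrow> (\<exists>s. Q x s)) \<Longrightarrow> semidecidable P"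
  unfolding semidecidable_def by blast

lemma decidable_comp2:
  assumes "decidable (\<lambda>z. Q (nfst z) (nsnd z))" "computable f" "computable g"
  shows "decidable (\<lambda>x. Q (f x) (g x))"
  using decidable_comp[OF assms(1) computable_encode[OF assms(2,3)]] by simp

lemma semidecidable_decidable: "decidable P \<Longrightarrow> semidecidable P"
  by (rule semidecidableI[where Q = "\<lambda>x s. P x"])
    (auto intro!: decidable_comp[of P] computable_intros)

lemma semidecidable_comp:
  assumes "semidecidable P" "computable f"
  shows "semidecidable (\<lambda>x. P (f x))"
proof -
  from assms(1) obtain Q where Q: "decidable (\<lambda>z. Q (nfst z) (nsnd z))" "\<And>x. P x \<longleftrightarrow> (\<exists>s. Q x s)"
    unfolding semidecidable_def by blast
  have "decidable (\<lambda>z. Q (f (nfst z)) (nsnd z))"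
    by (intro decidable_comp2[OF Q(1)] computable_comp[OF assms(2)] computable_intros)
  then show ?thesis by (rule semidecidableI[where Q = "\<lambda>x. Q (f x)"]) (simp add: Q(2))
qed

lemma semidecidable_ex:
  assumes "semidecidable (\<lambda>z. P (nfst z) (nsnd z))"
  shows "semidecidable (\<lambda>x. \<exists>m. P x m)"
proof -
  from assms obtain Q where Q: "decidable (\<lambda>z. Q (nfst z) (nsnd z))"
    "\<And>z. P (nfst z) (nsnd z) \<longleftrightarrow> (\<exists>s. Q z s)"
    unfolding semidecidable_def by blast
  have "decidable (\<lambda>z. Q (prod_encode (nfst z, nfst (nsnd z))) (nsnd (nsnd z)))"
    by (intro decidable_comp2[OF Q(1)] computable_intros)
  moreover have "P x m \<longleftrightarrow> (\<exists>s. Q (prod_encode (x, m)) s)" for x m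
    using Q(2)[of "prod_encode (x, m)"] by simp
  ultimately show ?thesis
    by (intro semidecidableI[where Q = "\<lambda>x s. Q (prod_encode (x, nfst s)) (nsnd s)"])
      (auto, metis nfst_encode nsnd_encode)
qed

lemma semidecidable_conj:
  assumes "semidecidable P" "semidecidable P'"
  shows "semidecidable (\<lambda>x. P x \<and> P' x)"
proof -
  from assms(1) obtain Q where Q: "decidable (\<lambda>z. Q (nfst z) (nsnd z))" "\<And>x. P x \<longleftrightarrow> (\<exists>s. Q x s)"
    unfolding semidecidable_def by blast
  from assms(2) obtain Q' where Q': "decidable (\<lambda>z. Q' (nfst z) (nsnd z))" "\<And>x. P' x \<longleftrightarrow> (\<exists>s. Q' x s)"
    unfolding semidecidable_def by blast
  have "decidable (\<lambda>z. Q (nfst z) (nfst (nsnd z)) \<and> Q' (nfst z) (nsnd (nsnd z)))"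
    by (intro decidable_conj decidable_comp2[OF Q(1)] decidable_comp2[OF Q'(1)] computable_intros)
  then show ?thesis
    by (rule semidecidableI[where Q = "\<lambda>x s. Q x (nfst s) \<and> Q' x (nsnd s)"])
      (auto simp: Q(2) Q'(2), metis nfst_encode nsnd_encode)
qed

lemma semidecidable_disj:
  assumes "semidecidable P" "semidecidable P'"
  shows "semidecidable (\<lambda>x. P x \<or> P' x)"
proof -
  from assms(1) obtain Q where Q: "decidable (\<lambda>z. Q (nfst z) (nsnd z))" "\<And>x. P x \<longleftrightarrow> (\<exists>s. Q x s)"
    unfolding semidecidable_def by blast
  from assms(2) obtain Q' where Q': "decidable (\<lambda>z. Q' (nfst z) (nsnd z))" "\<And>x. P' x \<longleftrightarrow> (\<exists>s. Q' x s)"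
    unfolding semidecidable_def by blast
  show ?thesis
    by (rule semidecidableI[where Q = "\<lambda>x s. Q x s \<or> Q' x s"])
      (auto simp: Q(2) Q'(2) intro: decidable_disj Q(1) Q'(1))
qed

text \<open>Finitely many witnesses have a common bound \<open>b\<close>, and this one number serves
  as witness for the whole bounded statement.\<close>

lemma semidecidable_ball:
  assumes "semidecidable (\<lambda>z. P (nfst z) (nsnd z))" and f: "computable f"
  shows "semidecidable (\<lambda>x. \<forall>m<f x. P x m)"
proof -
  from assms(1) obtain Q where Q: "decidable (\<lambda>z. Q (nfst z) (nsnd z))"
    "\<And>z. P (nfst z) (nsnd z) \<longleftrightarrow> (\<exists>s. Q z s)"
    unfolding semidecidable_def by blast
  have "decidable (\<lambda>z. \<forall>m<f (nfst z). \<exists>s<nsnd z. Q (prod_encode (nfst z, m)) s)"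
    by (intro decidable_ball decidable_bex decidable_comp2[OF Q(1)] computable_comp[OF f]
        computable_intros)
  moreover have "(\<forall>m<f x. P x m) \<longleftrightarrow> (\<exists>b. \<forall>m<f x. \<exists>s<b. Q (prod_encode (x, m)) s)" for x
  proof
    assume "\<forall>m<f x. P x m"
    then have "\<forall>m<f x. \<exists>s. Q (prod_encode (x, m)) s"
      using Q(2)[of "prod_encode (x, _)"] by simp
    then obtain s where s: "\<And>m. m < f x \<Longrightarrow> Q (prod_encode (x, m)) (s m)"
      by metis
    \<comment> \<open>The assumption \<open>m < f x\<close> makes the image nonempty, so that
      \<open>Max\<close> is meaningful.\<close>
    have "s m < Suc (Max (s ` {..<f x}))" if "m < f x" for m
      using that by (simp add: less_Suc_eq_le)
    with s show "\<exists>b. \<forall>m<f x. \<exists>s<b. Q (prod_encode (x, m)) s" by blast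
  next
    assume "\<exists>b. \<forall>m<f x. \<exists>s<b. Q (prod_encode (x, m)) s"
    then show "\<forall>m<f x. P x m" using Q(2)[of "prod_encode (x, _)"] by auto
  qed
  ultimately show ?thesis
    by (rule semidecidableI[where Q = "\<lambda>x b. \<forall>m<f x. \<exists>s<b. Q (prod_encode (x, m)) s"])
qed

text \<open>With these rules the shape of a formula suffices: conjunction, disjunction, existential
  and bounded universal quantifiers over equations and strict inequalities of computable
  terms.\<close>

lemmas semidecidable_intros = semidecidable_conj semidecidable_disj semidecidable_ex
  semidecidable_ball semidecidable_decidable[OF decidable_eq]
  semidecidable_decidable[OF decidable_less] computable_intros

lemma semidecidable_comp3:
  assumes "semidecidable (\<lambda>z. R (nfst z) (nfst (nsnd z)) (nsnd (nsnd z)))"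
    and "computable f" "computable g" "computable h"
  shows "semidecidable (\<lambda>x. R (f x) (g x) (h x))"
  using semidecidable_comp[OF assms(1) computable_encode[OF assms(2) computable_encode[OF assms(3,4)]]]
  by simp

text \<open>Post's theorem, pointwise: the search for a witness of \<open>P\<close> or
  \<open>Q\<close> halts, and the witness found tells which holds. The program depends on
  \<open>P\<close> and \<open>Q\<close> only; inputs where they are not complementary are tolerated,
  with no claim about them.\<close>

lemma decider_if_complementary:
  assumes "semidecidable P" "semidecidable Q"
  shows "\<exists>p. \<forall>n. (P n \<longleftrightarrow> \<not> Q n) \<longrightarrow> evals p n (if P n then 1 else 0)"
proof -
  from assms(1) obtain P' where P: "decidable (\<lambda>z. P' (nfst z) (nsnd z))" "\<And>x. P x \<longleftrightarrow> (\<exists>s. P' x s)"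
    unfolding semidecidable_def by blast
  from assms(2) obtain Q' where Q: "decidable (\<lambda>z. Q' (nfst z) (nsnd z))" "\<And>x. Q x \<longleftrightarrow> (\<exists>s. Q' x s)"
    unfolding semidecidable_def by blast
  obtain f where f: "\<And>z. evals f z
      (if P' (nfst z) (nsnd z) \<or> Q' (nfst z) (nsnd z) then 0 else 1)"
    using decidable_disj[OF P(1) Q(1)] unfolding decidable_def computable_def by blast
  obtain g where g: "\<And>z. evals g z (if P' (nfst z) (nsnd z) then 1 else 0)"
    using computable_if[OF P(1) computable_const computable_const, of 1 0]
    unfolding computable_def by blast
  have "evals (Comp g (Pair (Pair Fst Snd) (Mu f))) n (if P n then 1 else 0)"
    if n: "P n \<longleftrightarrow> \<not> Q n" for n
  proof -
    define s where "s = (LEAST s. P' n s \<or> Q' n s)"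
    have "\<exists>s. P' n s \<or> Q' n s" using n P(2) Q(2) by blast
    then have s: "P' n s \<or> Q' n s" unfolding s_def by (rule LeastI_ex)
    have less: "\<not> (P' n m \<or> Q' n m)" if "m < s" for m
      using that unfolding s_def by (rule not_less_Least)
    have "evals (Mu f) n s"
    proof (rule evals_Mu)
      show "evals f (prod_encode (n, s)) 0" using f[of "prod_encode (n, s)"] s by simp
      show "\<exists>k. evals f (prod_encode (n, m)) (Suc k)" if "m < s" for m
        using f[of "prod_encode (n, m)"] less[OF that] by (intro exI[of _ 0]) simp
    qed
    then have "evals (Pair (Pair Fst Snd) (Mu f)) n (prod_encode (n, s))"
      by (rule evals_Pair[OF evals_id])
    \<comment> \<open>If \<open>s\<close> does not witness \<open>P\<close>, it witnesses
      \<open>Q\<close> and so excludes \<open>P n\<close>.\<close>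
    moreover have "(if P' n s then 1 else 0) = (if P n then 1 else 0 :: nat)"
      using s n P(2) Q(2) by auto
    ultimately show ?thesis using g[of "prod_encode (n, s)"] by (auto intro: evals_Comp)
  qed
  then show ?thesis by blast
qed


section \<open>Derivability in a semidecidable rule system\<close>

text \<open>A nonempty list is coded as the successor of the pair of its head and the code of its
  tail, so this is \<open>drop\<close> on codes.\<close>

definition suffix :: "nat \<Rightarrow> nat \<Rightarrow> nat" where
  "suffix c = rec_nat c (\<lambda>i r. nsnd (r - 1))"

text \<open>An index beyond the end of the list coded by \<open>c\<close> yields a junk value; derivations below
  therefore come with an explicit bound \<open>n\<close> on the indices.\<close>

definition entry :: "nat \<Rightarrow> nat \<Rightarrow> nat" where
  "entry c i = nfst (suffix c i - 1)"

text \<open>As \<open>0 - 1 = 0\<close>, the code \<open>0\<close> of the empty list is a fixed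
  point of taking tails, which keeps \<open>suffix\<close> correct beyond the end of a list.\<close>

lemma nsnd_0 [simp]: "nsnd 0 = 0"
  using nsnd_encode[of 0 0] by (simp add: prod_encode_def)

lemma suffix_list_encode: "suffix (list_encode xs) i = list_encode (drop i xs)"
proof (induction i)
  case 0
  show ?case by (simp add: suffix_def)
next
  case (Suc i)
  have "nsnd (list_encode ys - 1) = list_encode (tl ys)" for ys
    by (cases ys) simp_all
  with Suc show ?case by (simp add: suffix_def drop_Suc tl_drop)
qed

lemma entry_list_encode: "i < length xs \<Longrightarrow> entry (list_encode xs) i = xs ! i"
  by (simp add: entry_def suffix_list_encode Cons_nth_drop_Suc[symmetric])

lemma computable_suffix:
  assumes "computable f" "computable g"
  shows "computable (\<lambda>x. suffix (f x) (g x))"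
  unfolding suffix_def by (intro computable_rec computable_intros computable_diff assms)

lemma computable_entry: "computable f \<Longrightarrow> computable g \<Longrightarrow> computable (\<lambda>x. entry (f x) (g x))"
  unfolding entry_def by (intro computable_intros computable_diff computable_suffix)

section \<open>Finite derivations and their codes\<close>

text \<open>The judgement \<open>0\<close> is derivable outright, so that axioms are rules with premises \<open>0\<close>.\<close>

inductive derivable :: "(nat \<Rightarrow> nat \<Rightarrow> nat \<Rightarrow> bool) \<Rightarrow> nat \<Rightarrow> bool" for R where
  derivable_0: "derivable R 0"
| derivable_rule: "R t t1 t2 \<Longrightarrow> derivable R t1 \<Longrightarrow> derivable R t2 \<Longrightarrow> derivable R t"

text \<open>A derivation tree flattened with its conclusion in front: premises stand to the right of
  what they justify.\<close>

fun derivation :: "(nat \<Rightarrow> nat \<Rightarrow> nat \<Rightarrow> bool) \<Rightarrow> nat list \<Rightarrow> bool" where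
  "derivation R [] \<longleftrightarrow> True"
| "derivation R (t # xs) \<longleftrightarrow>
    derivation R xs \<and> (t = 0 \<or> (\<exists>a \<in> set xs. \<exists>b \<in> set xs. R t a b))"

lemma derivation_append: "derivation R xs \<Longrightarrow> derivation R ys \<Longrightarrow> derivation R (xs @ ys)"
  by (induction xs) auto

lemma derivation_if_derivable: "derivable R t \<Longrightarrow> \<exists>xs. derivation R (t # xs)"
proof (induction rule: derivable.induct)
  case derivable_0
  show ?case by (intro exI[of _ "[]"]) simp
next
  case (derivable_rule t t1 t2)
  then obtain xs ys where xs: "derivation R (t1 # xs)" and ys: "derivation R (t2 # ys)" by blast
  have "derivation R (t # (t1 # xs) @ (t2 # ys))"
    using derivation_append[OF xs ys] derivable_rule.hyps(1) by auto
  then show ?case by blast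
qed

lemma derivation_nth:
  assumes "derivation R xs" "i < length xs" "xs ! i \<noteq> 0"
  shows "\<exists>j k. i < j \<and> j < length xs \<and> i < k \<and> k < length xs \<and> R (xs ! i) (xs ! j) (xs ! k)"
  using assms
proof (induction xs arbitrary: i)
  case Nil
  then show ?case by simp
next
  case (Cons t xs)
  show ?case
  proof (cases i)
    case 0
    with Cons.prems obtain a b where ab: "a \<in> set xs" "b \<in> set xs" "R t a b" by auto
    from ab(1,2) obtain j k where "j < length xs" "xs ! j = a" "k < length xs" "xs ! k = b"
      by (metis in_set_conv_nth)
    with ab(3) 0 have "i < Suc j \<and> Suc j < length (t # xs) \<and> i < Suc k \<and> Suc k < length (t # xs) \<and>
        R ((t # xs) ! i) ((t # xs) ! Suc j) ((t # xs) ! Suc k)" by simp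
    then show ?thesis by blast
  next
    case (Suc i')
    with Cons.prems Cons.IH[of i'] obtain j k where "i' < j" "j < length xs" "i' < k"
      "k < length xs" "R (xs ! i') (xs ! j) (xs ! k)" by auto
    with Suc have "i < Suc j \<and> Suc j < length (t # xs) \<and> i < Suc k \<and> Suc k < length (t # xs) \<and>
        R ((t # xs) ! i) ((t # xs) ! Suc j) ((t # xs) ! Suc k)" by simp
    then show ?thesis by blast
  qed
qed

text \<open>A derivation becomes a pair of numbers, and its correctness needs only a bounded
  universal quantifier. The converse holds even with junk entries: premises have larger indices
  below \<open>n\<close>, so induction on \<open>n - i\<close> applies.\<close>

lemma derivable_iff:
  "derivable R t \<longleftrightarrow> (\<exists>c n. 0 < n \<and> entry c 0 = t \<and> (\<forall>i<n. entry c i = 0 \<or>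
    (\<exists>j k. i < j \<and> j < n \<and> i < k \<and> k < n \<and> R (entry c i) (entry c j) (entry c k))))"
  (is "_ \<longleftrightarrow> (\<exists>c n. ?D c n)")
proof
  assume "derivable R t"
  then obtain xs where xs: "derivation R (t # xs)"
    using derivation_if_derivable by blast
  let ?xs = "t # xs" and ?c = "list_encode (t # xs)"
  have "?D ?c (length ?xs)"
  proof (intro conjI allI impI)
    show "0 < length ?xs" by simp
    show "entry ?c 0 = t" using entry_list_encode[of 0 ?xs] by simp
    fix i assume i: "i < length ?xs"
    show "entry ?c i = 0 \<or> (\<exists>j k. i < j \<and> j < length ?xs \<and> i < k \<and> k < length ?xs \<and>
        R (entry ?c i) (entry ?c j) (entry ?c k))"
    proof (cases "?xs ! i = 0")
      case True
      then show ?thesis using entry_list_encode[OF i] by metis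
    next
      case False
      from derivation_nth[OF xs i this] obtain j k where jk: "i < j" "j < length ?xs" "i < k"
        "k < length ?xs" "R (?xs ! i) (?xs ! j) (?xs ! k)" by blast
      from jk(5) have "R (entry ?c i) (entry ?c j) (entry ?c k)"
        unfolding entry_list_encode[OF i] entry_list_encode[OF jk(2)] entry_list_encode[OF jk(4)] .
      with jk show ?thesis by blast
    qed
  qed
  then show "\<exists>c n. ?D c n" by blast
next
  assume "\<exists>c n. ?D c n"
  then obtain c n where n: "0 < n" and t: "entry c 0 = t"
    and D: "\<forall>i<n. entry c i = 0 \<or> (\<exists>j k. i < j \<and> j < n \<and> i < k \<and> k < n \<and>
      R (entry c i) (entry c j) (entry c k))"
    by (elim exE conjE) (rule that)
  have "derivable R (entry c i)" if "i < n" for i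
    using that
  proof (induction "n - i" arbitrary: i rule: less_induct)
    case less
    show ?case
    proof (cases "entry c i = 0")
      case True
      then show ?thesis by (simp add: derivable_0)
    next
      case False
      with D[rule_format, OF less.prems] obtain j k where jk: "i < j" "j < n" "i < k" "k < n"
        and R: "R (entry c i) (entry c j) (entry c k)" by (elim disjE exE conjE) auto
      have "derivable R (entry c j)" "derivable R (entry c k)"
        using jk by (auto intro!: less.hyps)
      with R show ?thesis by (rule derivable_rule)
    qed
  qed
  from this[OF n] t show "derivable R t" by simp
qed

lemma semidecidable_derivable:
  assumes "semidecidable (\<lambda>z. R (nfst z) (nfst (nsnd z)) (nsnd (nsnd z)))"
  shows "semidecidable (derivable R)"
  unfolding derivable_iff[abs_def]
  by (intro semidecidable_intros computable_entry semidecidable_comp3[OF assms])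


section \<open>A universal interpreter\<close>

text \<open>\<open>Suc\<close> keeps judgements apart from the trivial judgement \<open>0\<close>,
  and the tag \<open>0\<close> separates this kind from the one tagged \<open>1\<close>.\<close>

abbreviation eval_judgement :: "nat \<Rightarrow> nat \<Rightarrow> nat \<Rightarrow> nat" where
  "eval_judgement c x y \<equiv> Suc (prod_encode (0, prod_encode (c, prod_encode (x, y))))"

text \<open>States that the program coded by \<open>c\<close> has a positive value at \<open>(a, m)\<close> for all \<open>m < n\<close>;
  it splits the unbounded number of premises of \<open>evals_Mu\<close> into binary rules.\<close>

abbreviation positive_judgement :: "nat \<Rightarrow> nat \<Rightarrow> nat \<Rightarrow> nat" where
  "positive_judgement c a n \<equiv> Suc (prod_encode (1, prod_encode (c, prod_encode (a, n))))"

text \<open>The clauses of \<open>evals\<close> on codes. In the compound cases the tags of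
  \<open>prog_code\<close> are written out and subcodes range over all numbers, so no rule has to
  check that a number codes a program.\<close>

inductive eval_rule :: "nat \<Rightarrow> nat \<Rightarrow> nat \<Rightarrow> bool" where
  "eval_rule (eval_judgement (prog_code Zero) n 0) 0 0"
| "eval_rule (eval_judgement (prog_code Succ) n (Suc n)) 0 0"
| "eval_rule (eval_judgement (prog_code Fst) (prod_encode (m, n)) m) 0 0"
| "eval_rule (eval_judgement (prog_code Snd) (prod_encode (m, n)) n) 0 0"
| "eval_rule (eval_judgement (prod_encode (4, prod_encode (f, g))) n (prod_encode (k, l)))
    (eval_judgement f n k) (eval_judgement g n l)"
| "eval_rule (eval_judgement (prod_encode (5, prod_encode (f, g))) n l)
    (eval_judgement g n k) (eval_judgement f k l)"
| "eval_rule (eval_judgement (prod_encode (6, prod_encode (f, g))) (prod_encode (a, 0)) k)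
    (eval_judgement f a k) 0"
| "eval_rule (eval_judgement (prod_encode (6, prod_encode (f, g))) (prod_encode (a, Suc n)) l)
    (eval_judgement (prod_encode (6, prod_encode (f, g))) (prod_encode (a, n)) k)
    (eval_judgement g (prod_encode (a, prod_encode (n, k))) l)"
| "eval_rule (positive_judgement f a 0) 0 0"
| "eval_rule (positive_judgement f a (Suc n)) (positive_judgement f a n)
    (eval_judgement f (prod_encode (a, n)) (Suc k))"
| "eval_rule (eval_judgement (prod_encode (7, f)) a n) (positive_judgement f a n)
    (eval_judgement f (prod_encode (a, n)) 0)"

text \<open>The relation is not recursive, so unfolding it yields a finite disjunction of
  existentially quantified equations.\<close>

lemma semidecidable_eval_rule:
  "semidecidable (\<lambda>z. eval_rule (nfst z) (nfst (nsnd z)) (nsnd (nsnd z)))"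
  unfolding eval_rule.simps by (intro semidecidable_intros)

definition eval_code :: "nat \<Rightarrow> nat \<Rightarrow> nat \<Rightarrow> bool" where
  "eval_code c x y \<longleftrightarrow> derivable eval_rule (eval_judgement c x y)"

lemma semidecidable_eval_code:
  "computable c \<Longrightarrow> computable f \<Longrightarrow> computable g \<Longrightarrow> semidecidable (\<lambda>x. eval_code (c x) (f x) (g x))"
  unfolding eval_code_def
  by (intro semidecidable_comp[OF semidecidable_derivable[OF semidecidable_eval_rule]]
      computable_intros)

section \<open>Correctness of the interpreter\<close>

text \<open>Both kinds of judgement are treated together because the rules for minimisation link
  them. Claims concern genuine program codes only, from which injectivity of
  \<open>prog_code\<close> recovers the program.\<close>

lemma derivable_sound:
  "derivable eval_rule t \<Longrightarrow>
    (\<forall>p x y. t = eval_judgement (prog_code p) x y \<longrightarrow> evals p x y) \<and>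
    (\<forall>p a n. t = positive_judgement (prog_code p) a n \<longrightarrow>
      (\<forall>m<n. \<exists>k. evals p (prod_encode (a, m)) (Suc k)))"
proof (induction rule: derivable.induct)
  case derivable_0
  show ?case by simp
next
  case (derivable_rule t t1 t2)
  from derivable_rule(1) show ?case
  proof cases
    case (1 n)
    have "evals p n 0" if "prog_code Zero = prog_code p" for p
      using injD[OF inj_prog_code that] evals_Zero by simp
    \<comment> \<open>\<open>prog_code\<close> stays folded so that the equation of codes matches
      the fact just proved.\<close>
    with 1 show ?thesis by (auto simp del: prog_code.simps)
  next
    case (2 n)
    have "evals p n (Suc n)" if "prog_code Succ = prog_code p" for p
      using injD[OF inj_prog_code that] evals_Succ by simp
    with 2 show ?thesis by (auto simp del: prog_code.simps)
  next
    case (3 m n)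
    have "evals p (prod_encode (m, n)) m" if "prog_code Fst = prog_code p" for p
      using injD[OF inj_prog_code that] evals_Fst by simp
    with 3 show ?thesis by (auto simp del: prog_code.simps)
  next
    case (4 m n)
    have "evals p (prod_encode (m, n)) n" if "prog_code Snd = prog_code p" for p
      using injD[OF inj_prog_code that] evals_Snd by simp
    with 4 show ?thesis by (auto simp del: prog_code.simps)
  next
    case (5 f g n k l)
    \<comment> \<open>A program code tagged \<open>4\<close> comes from a \<open>Pair\<close> and
      its components are program codes again, which makes the induction hypotheses applicable. The
      later compound cases proceed likewise.\<close>
    have *: "\<exists>q r. p = Pair q r \<and> f = prog_code q \<and> g = prog_code r"
      if "prod_encode (4, prod_encode (f, g)) = prog_code p" for p
      using that by (cases p) simp_all
    have "evals p n (prod_encode (k, l))"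
      if p: "prod_encode (4, prod_encode (f, g)) = prog_code p" for p
    proof -
      from *[OF p] obtain q r where qr: "p = Pair q r" "f = prog_code q" "g = prog_code r" by blast
      have "evals q n k" "evals r n l"
        using derivable_rule.IH 5 qr(2,3) by simp_all
      then show ?thesis unfolding qr(1) by (rule evals_Pair)
    qed
    with 5 show ?thesis by auto
  next
    case (6 f g n l k)
    have *: "\<exists>q r. p = Comp q r \<and> f = prog_code q \<and> g = prog_code r"
      if "prod_encode (5, prod_encode (f, g)) = prog_code p" for p
      using that by (cases p) simp_all
    have "evals p n l"
      if p: "prod_encode (5, prod_encode (f, g)) = prog_code p" for p
    proof -
      from *[OF p] obtain q r where qr: "p = Comp q r" "f = prog_code q" "g = prog_code r" by blast
      have "evals r n k" "evals q k l"
        using derivable_rule.IH 6 qr(2,3) by simp_all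
      then show ?thesis unfolding qr(1) by (rule evals_Comp)
    qed
    with 6 show ?thesis by auto
  next
    case (7 f g a k)
    have *: "\<exists>q r. p = PRec q r \<and> f = prog_code q \<and> g = prog_code r"
      if "prod_encode (6, prod_encode (f, g)) = prog_code p" for p
      using that by (cases p) simp_all
    have "evals p (prod_encode (a, 0)) k"
      if p: "prod_encode (6, prod_encode (f, g)) = prog_code p" for p
    proof -
      from *[OF p] obtain q r where qr: "p = PRec q r" "f = prog_code q" "g = prog_code r" by blast
      have "evals q a k"
        using derivable_rule.IH 7 qr(2,3) by simp_all
      then show ?thesis unfolding qr(1) by (rule evals_PRec_0)
    qed
    with 7 show ?thesis by auto
  next
    case (8 f g a n l k)
    have *: "\<exists>q r. p = PRec q r \<and> f = prog_code q \<and> g = prog_code r"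
      if "prod_encode (6, prod_encode (f, g)) = prog_code p" for p
      using that by (cases p) simp_all
    have "evals p (prod_encode (a, Suc n)) l"
      if p: "prod_encode (6, prod_encode (f, g)) = prog_code p" for p
    proof -
      from *[OF p] obtain q r where qr: "p = PRec q r" "g = prog_code r" by blast
      \<comment> \<open>The first premise concerns \<open>p\<close> itself rather than a subprogram;
        induction on derivations covers this too.\<close>
      have "evals p (prod_encode (a, n)) k" "evals r (prod_encode (a, prod_encode (n, k))) l"
        using derivable_rule.IH 8 p qr(2) by simp_all
      then show ?thesis unfolding qr(1) by (rule evals_PRec_Suc)
    qed
    with 8 show ?thesis by auto
  next
    case (9 f a)
    then show ?thesis by auto
  next
    case (10 f a n k)
    have "\<exists>k. evals p (prod_encode (a, m)) (Suc k)" if p: "f = prog_code p" and m: "m < Suc n" for p m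
    proof -
      have "\<forall>m<n. \<exists>k. evals p (prod_encode (a, m)) (Suc k)"
        using derivable_rule.IH(1) 10(2) p by simp
      moreover have "evals p (prod_encode (a, n)) (Suc k)"
        using derivable_rule.IH(2) 10(3) p by simp
      ultimately show ?thesis using m by (auto simp: less_Suc_eq)
    qed
    with 10(1) show ?thesis by simp
  next
    case (11 f a n)
    have *: "\<exists>q. p = Mu q \<and> f = prog_code q" if "prod_encode (7, f) = prog_code p" for p
      using that by (cases p) simp_all
    have "evals p a n" if p: "prod_encode (7, f) = prog_code p" for p
    proof -
      from *[OF p] obtain q where q: "p = Mu q" "f = prog_code q" by blast
      have "evals q (prod_encode (a, n)) 0"
        using derivable_rule.IH(2) 11(3) q(2) by simp
      moreover have "\<forall>m<n. \<exists>k. evals q (prod_encode (a, m)) (Suc k)"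
        using derivable_rule.IH(1) 11(2) q(2) by simp
      ultimately show ?thesis unfolding q(1) by (intro evals_Mu) auto
    qed
    with 11(1) show ?thesis by simp
  qed
qed

lemmas derivable_eval_rule = derivable_rule[where R = eval_rule]

lemma eval_code_if_evals: "evals p x y \<Longrightarrow> eval_code (prog_code p) x y"
  unfolding eval_code_def
proof (induction rule: evals.induct)
  case (evals_Zero n)
  show ?case by (rule derivable_eval_rule[OF eval_rule.intros(1) derivable_0 derivable_0])
next
  case (evals_Succ n)
  show ?case by (rule derivable_eval_rule[OF eval_rule.intros(2) derivable_0 derivable_0])
next
  case (evals_Fst m n)
  show ?case by (rule derivable_eval_rule[OF eval_rule.intros(3) derivable_0 derivable_0])
next
  case (evals_Snd m n)
  show ?case by (rule derivable_eval_rule[OF eval_rule.intros(4) derivable_0 derivable_0])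
next
  case (evals_Pair f n k g l)
  from derivable_eval_rule[OF eval_rule.intros(5) evals_Pair.IH]
  show ?case unfolding prog_code.simps .
next
  case (evals_Comp g n k f l)
  from derivable_eval_rule[OF eval_rule.intros(6) evals_Comp.IH]
  show ?case unfolding prog_code.simps .
next
  case (evals_PRec_0 f a k g)
  from derivable_eval_rule[OF eval_rule.intros(7) evals_PRec_0.IH derivable_0]
  show ?case unfolding prog_code.simps .
next
  case (evals_PRec_Suc f g a n k l)
  from derivable_eval_rule[OF eval_rule.intros(8) evals_PRec_Suc.IH[unfolded prog_code.simps]]
  show ?case unfolding prog_code.simps .
next
  case (evals_Mu f a n)
  \<comment> \<open>The values of \<open>f\<close> below \<open>n\<close> are collected one by one
    into a single positive judgement.\<close>
  have "m \<le> n \<Longrightarrow> derivable eval_rule (positive_judgement (prog_code f) a m)" for m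
  proof (induction m)
    case 0
    show ?case by (rule derivable_eval_rule[OF eval_rule.intros(9) derivable_0 derivable_0])
  next
    case (Suc m)
    with evals_Mu.IH(2)[of m] obtain k where
      k: "derivable eval_rule (eval_judgement (prog_code f) (prod_encode (a, m)) (Suc k))" by auto
    from Suc have "derivable eval_rule (positive_judgement (prog_code f) a m)" by simp
    from derivable_eval_rule[OF eval_rule.intros(10) this k] show ?case .
  qed
  from derivable_eval_rule[OF eval_rule.intros(11) this[OF order_refl] evals_Mu.IH(1)]
  show ?case unfolding prog_code.simps .
qed

lemma eval_code_iff: "eval_code (prog_code p) x y \<longleftrightarrow> evals p x y"
  using eval_code_if_evals derivable_sound unfolding eval_code_def by blast


section \<open>Semidecidability of termination and of self-covering runs\<close>

text \<open>A member of a list is the head of some suffix; this expresses membership in a coded list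
  by an equation of computable terms.\<close>

lemma suffix_list_encode_eq_Cons_iff:
  "(\<exists>m l. suffix (list_encode xs) m = Suc (prod_encode (y, l))) \<longleftrightarrow> y \<in> set xs"
proof
  assume "\<exists>m l. suffix (list_encode xs) m = Suc (prod_encode (y, l))"
  then obtain m l where m: "list_encode (drop m xs) = Suc (prod_encode (y, l))"
    by (auto simp: suffix_list_encode)
  then have "y \<in> set (drop m xs)" by (cases "drop m xs") auto
  then show "y \<in> set xs" by (rule in_set_dropD)
next
  assume "y \<in> set xs"
  then obtain m where m: "m < length xs" "xs ! m = y" by (auto simp: in_set_conv_nth)
  then have "suffix (list_encode xs) m = Suc (prod_encode (y, list_encode (drop (Suc m) xs)))"
    by (simp add: suffix_list_encode flip: Cons_nth_drop_Suc)
  then show "\<exists>m l. suffix (list_encode xs) m = Suc (prod_encode (y, l))" by blast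
qed

text \<open>The judgement \<open>(c, l)\<close> says that no state in the list \<open>l\<close> starts an infinite run, where
  \<open>c\<close> codes the program computing successors.\<close>

inductive termination_rule :: "nat \<Rightarrow> nat \<Rightarrow> nat \<Rightarrow> bool" where
  Nil: "termination_rule (Suc (prod_encode (c, 0))) 0 0"
| Cons: "eval_code c x k \<Longrightarrow>
    termination_rule (Suc (prod_encode (c, Suc (prod_encode (x, l)))))
      (Suc (prod_encode (c, k))) (Suc (prod_encode (c, l)))"

definition terminating_code :: "nat \<Rightarrow> nat \<Rightarrow> bool" where
  "terminating_code c l \<longleftrightarrow> derivable termination_rule (Suc (prod_encode (c, l)))"

lemma semidecidable_terminating_code:
  assumes "computable c" "computable l"
  shows "semidecidable (\<lambda>x. terminating_code (c x) (l x))"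
proof -
  have "semidecidable (\<lambda>z. termination_rule (nfst z) (nfst (nsnd z)) (nsnd (nsnd z)))"
    unfolding termination_rule.simps by (intro semidecidable_intros semidecidable_eval_code)
  then show ?thesis
    unfolding terminating_code_def
    by (intro semidecidable_comp[OF semidecidable_derivable] computable_intros assms)
qed

lemma terminating_code_Nil: "terminating_code c 0"
  unfolding terminating_code_def
  by (rule derivable_rule[where R = termination_rule, OF termination_rule.Nil derivable_0 derivable_0])

lemma terminating_code_ConsI:
  "eval_code c x k \<Longrightarrow> terminating_code c k \<Longrightarrow> terminating_code c l \<Longrightarrow>
    terminating_code c (Suc (prod_encode (x, l)))"
  unfolding terminating_code_def by (rule derivable_rule[where R = termination_rule, OF termination_rule.Cons])

lemma terminating_code_ConsD:
  assumes "terminating_code c (Suc (prod_encode (x, l)))"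
  shows "\<exists>k. eval_code c x k \<and> terminating_code c k"
  using assms unfolding terminating_code_def
proof (cases rule: derivable.cases)
  case (derivable_rule t1 t2)
  from derivable_rule(1) show "\<exists>k. eval_code c x k \<and>
      derivable termination_rule (Suc (prod_encode (c, k)))"
    by cases (use derivable_rule(2) in auto)
qed

text \<open>Rule induction with \<open>c\<close> held fixed, as \<open>termination_rule.Cons\<close>
  passes the same program code to both premises.\<close>

lemma terminating_code_induct [consumes 1, case_names Nil Cons]:
  assumes "terminating_code c l" "P 0"
    and "\<And>x k l. eval_code c x k \<Longrightarrow> P k \<Longrightarrow> P l \<Longrightarrow> P (Suc (prod_encode (x, l)))"
  shows "P l"
proof -
  have "t = Suc (prod_encode (c, l)) \<Longrightarrow> P l" if "derivable termination_rule t" for t l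
    using that
  proof (induction arbitrary: l rule: derivable.induct)
    case derivable_0
    then show ?case by simp
  next
    case (derivable_rule t t1 t2)
    from derivable_rule.hyps(1) derivable_rule.prems derivable_rule.IH show ?case
      by cases (auto intro: assms(2,3))
  qed
  with assms(1) show ?thesis unfolding terminating_code_def by blast
qed

text \<open>Entries \<open>0\<close> to \<open>j\<close> of \<open>r\<close> number the states of a
  run. The equation with \<open>suffix\<close> places the next entry in the computed successor list
  \<open>l\<close>, and \<open>1\<close> is the positive answer of the ordering program.\<close>

definition self_covering_code :: "nat \<Rightarrow> nat \<Rightarrow> nat \<Rightarrow> bool" where
  "self_covering_code c d x \<longleftrightarrow> (\<exists>r i j. i < j \<and> entry r 0 = x \<and>
    (\<forall>k<j. \<exists>l m l'. eval_code c (entry r k) l \<and> suffix l m = Suc (prod_encode (entry r (Suc k), l'))) \<and>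
    eval_code d (prod_encode (entry r i, entry r j)) 1)"

lemma semidecidable_self_covering_code:
  assumes "computable c" "computable d" "computable f"
  shows "semidecidable (\<lambda>x. self_covering_code (c x) (d x) (f x))"
  unfolding self_covering_code_def
  by (intro semidecidable_intros semidecidable_eval_code computable_entry computable_suffix
      computable_comp[OF assms(1)] computable_comp[OF assms(2)] computable_comp[OF assms(3)])


section \<open>Self-covering runs of branch-WSTS\<close>

lemma step_states: "is_olts S \<Longrightarrow> step S x y \<Longrightarrow> x \<in> states S \<and> y \<in> states S"
  unfolding is_olts_def step_def by blast

lemma word_step_states: "is_olts S \<Longrightarrow> word_step S x w y \<Longrightarrow> x \<in> states S \<Longrightarrow> y \<in> states S"
proof (induction w arbitrary: x)
  case (Cons a w)
  then show ?case using step_states[of S] unfolding step_def by auto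
qed simp

lemma word_step_if_steps:
  assumes "is_olts S" "\<And>k. k < n \<Longrightarrow> step S (f k) (f (Suc k))"
  shows "\<exists>w \<in> lists (alphabet S). length w = n \<and> word_step S (f 0) w (f n)"
  using assms(2)
proof (induction n arbitrary: f)
  case 0
  show ?case by (intro bexI[of _ "[]"]) auto
next
  case (Suc n)
  from Suc.prems[of 0] obtain a where a: "(f 0, a, f 1) \<in> transitions S" by (auto simp: step_def)
  then have "a \<in> alphabet S" using assms(1) unfolding is_olts_def by blast
  moreover obtain w where "w \<in> lists (alphabet S)" "length w = n" "word_step S (f 1) w (f (Suc n))"
    using Suc.IH[of "\<lambda>k. f (Suc k)"] Suc.prems by auto
  ultimately show ?case using a by (intro bexI[of _ "a # w"]) auto
qed

text \<open>The system can keep following a self-covering word \<open>w\<close>: once \<open>w\<close> has been read,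
  monotonicity provides another self-covering copy of it.\<close>

lemma infinite_run_if_self_covering:
  assumes S: "is_olts S" "branch_monotone S"
    and f0: "f 0 = initial S" and steps: "\<And>k. k < j \<Longrightarrow> step S (f k) (f (Suc k))"
    and ij: "i < j" "(f i, f j) \<in> qorder S"
  shows "non_terminating S"
proof -
  \<comment> \<open>An invariant for the infinite run: \<open>v\<close> remains to be read before
    the next round, and the nonempty \<open>w\<close> is a self-covering round.\<close>
  define B where "B z \<longleftrightarrow> z \<in> states S \<and> (\<exists>v w y y'. v \<in> lists (alphabet S) \<and>
    w \<in> lists (alphabet S) \<and> w \<noteq> [] \<and> word_step S z v y \<and> word_step S y w y' \<and>
    (y, y') \<in> qorder S)" for z
  have B_step: "\<exists>z'. B z' \<and> step S z z'" if "B z" for z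
  proof -
    from that obtain v w y y' where B: "z \<in> states S" "v \<in> lists (alphabet S)"
      "w \<in> lists (alphabet S)" "w \<noteq> []" "word_step S z v y" "word_step S y w y'"
      "(y, y') \<in> qorder S" unfolding B_def by blast
    show ?thesis
    proof (cases v)
      case (Cons a v')
      with B obtain z' where z': "(z, a, z') \<in> transitions S" "word_step S z' v' y" by auto
      then have "step S z z'" by (auto simp: step_def)
      moreover from this have "z' \<in> states S" using step_states[OF S(1)] by blast
      moreover have "v' \<in> lists (alphabet S)" using B(2) Cons by simp
      ultimately show ?thesis using z' B(3,4,6,7) unfolding B_def by blast
    next
      case Nil
      with B have y: "y = z" by simp
      have y': "y' \<in> states S" using word_step_states[OF S(1) B(6)] B(1) y by simp
      \<comment> \<open>Monotonicity supplies the following round, from \<open>y'\<close> to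
        \<open>y''\<close>. The first letter of \<open>w\<close> is read now, and its remainder
        \<open>w'\<close> takes over the role of \<open>v\<close>.\<close>
      with S(2) B y obtain y'' where y'': "word_step S y' w y''" "(y', y'') \<in> qorder S"
        unfolding branch_monotone_def by blast
      from B(4) obtain a w' where w: "w = a # w'" by (cases w) auto
      with B(6) y obtain z' where z': "(z, a, z') \<in> transitions S" "word_step S z' w' y'" by auto
      then have "step S z z'" by (auto simp: step_def)
      moreover from this have "z' \<in> states S" using step_states[OF S(1)] by blast
      moreover have "w' \<in> lists (alphabet S)" using B(3) w by simp
      ultimately show ?thesis using z' B(3,4) y'' unfolding B_def by blast
    qed
  qed
  obtain v where v: "v \<in> lists (alphabet S)" "word_step S (f 0) v (f i)"
    using word_step_if_steps[OF S(1), of i f] steps ij by auto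
  obtain w where w: "w \<in> lists (alphabet S)" "length w = j - i" "word_step S (f i) w (f j)"
    using word_step_if_steps[OF S(1), of "j - i" "\<lambda>k. f (i + k)"] steps ij by auto
  have "w \<noteq> []" using w(2) ij by auto
  moreover have "initial S \<in> states S" using S(1) unfolding is_olts_def by blast
  ultimately have B0: "B (initial S)" unfolding B_def using v w ij f0 by metis
  have "\<exists>g. \<forall>n. (B (g n) \<and> (n = 0 \<longrightarrow> g n = initial S)) \<and> step S (g n) (g (Suc n))"
    using B0 B_step by (intro dependent_nat_choice) auto
  then show ?thesis unfolding non_terminating_def infinite_run_def by blast
qed


section \<open>The decision procedure\<close>

locale effective_olts =
  fixes S :: "('x, 'a) olts" and enc :: "'x \<Rightarrow> nat" and ord_prog post_prog :: prog
  assumes olts: "is_olts S"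
    and inj: "inj_on enc (states S)"
    and ord: "decides_rel enc (states S) (qorder S) ord_prog"
    and post: "computes_Post enc S post_prog"
begin

text \<open>Determinism of \<open>evals\<close> makes the promised output the only one.\<close>

lemma eval_post:
  assumes "x \<in> states S"
  obtains ys where "set ys = Post S x" "set ys \<subseteq> states S"
    "\<And>l. eval_code (prog_code post_prog) (enc x) l \<longleftrightarrow> l = list_encode (map enc ys)"
proof -
  from post assms obtain ys where ys: "set ys = Post S x"
    "evals post_prog (enc x) (list_encode (map enc ys))"
    unfolding computes_Post_def by blast
  have "set ys \<subseteq> states S" using ys(1) step_states[OF olts] unfolding Post_def by blast
  then show ?thesis
    using ys by (intro that[of ys]) (auto simp: eval_code_iff dest: evals_deterministic)
qed

lemma eval_ord:
  assumes "x \<in> states S" "y \<in> states S"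
  shows "eval_code (prog_code ord_prog) (prod_encode (enc x, enc y)) 1 \<longleftrightarrow> (x, y) \<in> qorder S"
proof -
  have "evals ord_prog (prod_encode (enc x, enc y)) (if (x, y) \<in> qorder S then 1 else 0)"
    using ord assms unfolding decides_rel_def by blast
  then show ?thesis
    by (auto simp: eval_code_iff split: if_splits dest: evals_deterministic)
qed

lemma eval_post_mem_iff:
  assumes "x \<in> states S"
  shows "(\<exists>l m l'. eval_code (prog_code post_prog) (enc x) l \<and>
      suffix l m = Suc (prod_encode (c, l'))) \<longleftrightarrow> (\<exists>y. step S x y \<and> c = enc y)"
proof -
  obtain ys where ys: "set ys = Post S x"
    "\<And>l. eval_code (prog_code post_prog) (enc x) l \<longleftrightarrow> l = list_encode (map enc ys)"
    using eval_post[OF assms] by metis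
  have "(\<exists>l m l'. eval_code (prog_code post_prog) (enc x) l \<and>
      suffix l m = Suc (prod_encode (c, l'))) \<longleftrightarrow> c \<in> set (map enc ys)"
    unfolding ys(2) suffix_list_encode_eq_Cons_iff[symmetric] by blast
  then show ?thesis using ys(1) by (auto simp: Post_def)
qed

text \<open>A run from a state in the tail is excluded by the hypothesis for \<open>l\<close>; a run
  from the head is, one step later, a run from a member of the successor list
  \<open>k\<close>.\<close>

lemma not_infinite_if_terminating_code:
  assumes "terminating_code (prog_code post_prog) l" "l = list_encode (map enc zs)"
    "set zs \<subseteq> states S" "g 0 \<in> set zs"
  shows "\<not> (\<forall>n. step S (g n) (g (Suc n)))"
  using assms
proof (induction arbitrary: zs g rule: terminating_code_induct)
  case Nil
  then show ?case by (cases zs) simp_all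
next
  case (Cons x k l)
  then obtain z zs' where zs: "zs = z # zs'" "x = enc z" "l = list_encode (map enc zs')"
    by (cases zs) auto
  show ?case
  proof (cases "g 0 \<in> set zs'")
    case True
    then show ?thesis using Cons.IH(2)[OF zs(3)] Cons.prems(2) zs(1) by simp
  next
    case False
    then have g: "g 0 = z" using Cons.prems(3) zs(1) by simp
    have "z \<in> states S" using Cons.prems(2) zs(1) by simp
    then obtain ys where ys: "set ys = Post S z" "set ys \<subseteq> states S" "k = list_encode (map enc ys)"
      using eval_post[of z] Cons.hyps zs(2) by metis
    show ?thesis
    proof
      assume steps: "\<forall>n. step S (g n) (g (Suc n))"
      then have "g (Suc 0) \<in> set ys" using ys(1) g by (auto simp: Post_def)
      from Cons.IH(1)[OF ys(3,2), of "\<lambda>n. g (Suc n)"] this steps show False by simp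
    qed
  qed
qed

text \<open>Inverting the derivation for each singleton yields the successor list needed to put that
  state in front of the others.\<close>

lemma terminating_code_list:
  "(\<And>z. z \<in> set zs \<Longrightarrow> terminating_code (prog_code post_prog) (list_encode [enc z])) \<Longrightarrow>
    set zs \<subseteq> states S \<Longrightarrow> terminating_code (prog_code post_prog) (list_encode (map enc zs))"
proof (induction zs)
  case Nil
  show ?case by (simp add: terminating_code_Nil)
next
  case (Cons z zs)
  have "terminating_code (prog_code post_prog) (list_encode [enc z])" using Cons.prems by simp
  then obtain k where k: "eval_code (prog_code post_prog) (enc z) k"
    "terminating_code (prog_code post_prog) k"
    by (auto dest: terminating_code_ConsD)
  have "terminating_code (prog_code post_prog) (list_encode (map enc zs))" using Cons by simp
  from terminating_code_ConsI[OF k this] show ?case by simp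
qed

lemma terminating_code_iff:
  "terminating_code (prog_code post_prog) (list_encode [enc (initial S)]) \<longleftrightarrow> \<not> non_terminating S"
proof
  assume t: "terminating_code (prog_code post_prog) (list_encode [enc (initial S)])"
  have "initial S \<in> states S" using olts unfolding is_olts_def by blast
  then show "\<not> non_terminating S"
    using not_infinite_if_terminating_code[OF t, of "[initial S]"]
    unfolding non_terminating_def infinite_run_def by auto
next
  let ?t = "\<lambda>z. terminating_code (prog_code post_prog) (list_encode [enc z])"
  assume nt: "\<not> non_terminating S"
  \<comment> \<open>Otherwise every successor has a derivation, and since the successors form a
    finite list these combine into one for \<open>x\<close>. Iterating by dependent choice then
    gives an infinite run.\<close>
  have next_state: "\<exists>y. (y \<in> states S \<and> \<not> ?t y) \<and> step S x y" if x: "x \<in> states S" "\<not> ?t x" for x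
  proof (rule ccontr)
    assume no: "\<not> ?thesis"
    obtain ys where ys: "set ys = Post S x" "set ys \<subseteq> states S"
      "\<And>l. eval_code (prog_code post_prog) (enc x) l \<longleftrightarrow> l = list_encode (map enc ys)"
      using eval_post[OF x(1)] by blast
    have "?t y" if "y \<in> set ys" for y
      using that ys(1,2) no by (auto simp: Post_def)
    then have "terminating_code (prog_code post_prog) (list_encode (map enc ys))"
      using ys(2) by (intro terminating_code_list)
    then have "?t x"
      using ys(3) terminating_code_ConsI[OF _ _ terminating_code_Nil] by simp
    with x(2) show False ..
  qed
  show "?t (initial S)"
  proof (rule ccontr)
    assume "\<not> ?t (initial S)"
    moreover have "initial S \<in> states S" using olts unfolding is_olts_def by blast
    ultimately have "\<exists>g. \<forall>n. ((g n \<in> states S \<and> \<not> ?t (g n)) \<and> (n = 0 \<longrightarrow> g n = initial S)) \<and>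
        step S (g n) (g (Suc n))"
      using next_state by (intro dependent_nat_choice) auto
    with nt show False unfolding non_terminating_def infinite_run_def by blast
  qed
qed

lemma self_covering_code_iff:
  assumes "branch_monotone S" "branch_wqo S"
  shows "self_covering_code (prog_code post_prog) (prog_code ord_prog) (enc (initial S)) \<longleftrightarrow>
    non_terminating S"
proof
  have init: "initial S \<in> states S" using olts unfolding is_olts_def by blast
  assume "self_covering_code (prog_code post_prog) (prog_code ord_prog) (enc (initial S))"
  then obtain r i j where ij: "i < j" and r0: "entry r 0 = enc (initial S)"
    and next_entry: "\<And>k. k < j \<Longrightarrow> \<exists>l m l'. eval_code (prog_code post_prog) (entry r k) l \<and>
      suffix l m = Suc (prod_encode (entry r (Suc k), l'))"
    and covers: "eval_code (prog_code ord_prog) (prod_encode (entry r i, entry r j)) 1"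
    unfolding self_covering_code_def by blast
  \<comment> \<open>The entries of \<open>r\<close> are arbitrary numbers; \<open>states\<close>
    below shows that up to index \<open>j\<close> they number states, so that
    \<open>inv_into\<close> decodes them.\<close>
  define f where "f k = inv_into (states S) enc (entry r k)" for k
  have f_enc: "f k = x" if "entry r k = enc x" "x \<in> states S" for k x
    using that inj by (simp add: f_def)
  have succ: "\<exists>y. step S x y \<and> entry r (Suc k) = enc y"
    if "k < j" "entry r k = enc x" "x \<in> states S" for k x
    using next_entry[OF that(1)] eval_post_mem_iff[OF that(3), of "entry r (Suc k)"] that(2) by simp
  have states: "\<exists>x \<in> states S. entry r k = enc x" if "k \<le> j" for k
    using that
  proof (induction k)
    case 0
    show ?case using r0 init by blast
  next
    case (Suc k)
    then show ?case using succ[of k] step_states[OF olts] by fastforce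
  qed
  have "step S (f k) (f (Suc k))" if k: "k < j" for k
  proof -
    from states[of k] k obtain x where x: "x \<in> states S" "entry r k = enc x" by auto
    from succ[OF k x(2,1)] obtain y where y: "step S x y" "entry r (Suc k) = enc y" by blast
    with x show ?thesis using f_enc step_states[OF olts y(1)] by metis
  qed
  moreover have "(f i, f j) \<in> qorder S"
  proof -
    from states[of i] states[of j] ij obtain x y where
      "x \<in> states S" "entry r i = enc x" "y \<in> states S" "entry r j = enc y" by auto
    with covers show ?thesis using f_enc eval_ord by metis
  qed
  ultimately show "non_terminating S"
    using f_enc[OF r0 init] ij by (intro infinite_run_if_self_covering[OF olts assms(1)])
next
  assume "non_terminating S"
  then obtain f where f: "infinite_run S f" unfolding non_terminating_def by blast
  then have f0: "f 0 = initial S" and steps: "\<And>k. step S (f k) (f (Suc k))"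
    unfolding infinite_run_def by auto
  have states: "f k \<in> states S" for k using steps step_states[OF olts] by blast
  \<comment> \<open>Branch-wqo is applied to \<open>f\<close> itself, as a sequence in its own
    range.\<close>
  obtain i j where ij: "i < j" "(f i, f j) \<in> qorder S"
    using assms(2) f unfolding branch_wqo_def wqo_on_def by blast
  define r where "r = list_encode (map (\<lambda>k. enc (f k)) [0..<Suc j])"
  have r: "entry r k = enc (f k)" if "k \<le> j" for k
    using that unfolding r_def
    by (subst entry_list_encode) (simp_all del: upt_Suc)
  have "\<exists>l m l'. eval_code (prog_code post_prog) (entry r k) l \<and>
      suffix l m = Suc (prod_encode (entry r (Suc k), l'))" if "k < j" for k
    using that eval_post_mem_iff[OF states[of k], of "enc (f (Suc k))"] steps[of k] r by auto
  moreover have "entry r 0 = enc (initial S)" using r[of 0] f0 by simp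
  moreover have "eval_code (prog_code ord_prog) (prod_encode (entry r i, entry r j)) 1"
    using eval_ord[OF states states, of i j] ij r by simp
  ultimately show "self_covering_code (prog_code post_prog) (prog_code ord_prog) (enc (initial S))"
    unfolding self_covering_code_def using ij(1) by blast
qed

end

theorem theorem3p15:
  shows "uniformly_decidable
    (\<lambda>S :: ('x, 'a) olts. branch_wsts S \<and> branch_effective S) non_terminating"
proof -
  \<comment> \<open>These read off a description the code of the successor program, that of the
    ordering program, and the number of the initial state.\<close>
  define c d x :: "nat \<Rightarrow> nat" where
    "c n = nfst (nsnd (nsnd n))" and "d n = nfst n" and "x n = nsnd (nsnd (nsnd n))" for n
  have computable: "computable c" "computable d" "computable x"
    unfolding c_def[abs_def] d_def[abs_def] x_def[abs_def] by (intro computable_intros)+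
  \<comment> \<open>The program is fixed before any system is considered, which gives uniformity.
    The number \<open>Suc (prod_encode (x n, 0))\<close> codes the list containing just
    \<open>x n\<close>.\<close>
  have "\<exists>p. \<forall>n. (self_covering_code (c n) (d n) (x n) \<longleftrightarrow>
      \<not> terminating_code (c n) (Suc (prod_encode (x n, 0)))) \<longrightarrow>
    evals p n (if self_covering_code (c n) (d n) (x n) then 1 else 0)"
    by (intro decider_if_complementary semidecidable_self_covering_code
        semidecidable_terminating_code computable computable_intros)
  then obtain p where p: "\<And>n. (self_covering_code (c n) (d n) (x n) \<longleftrightarrow>
      \<not> terminating_code (c n) (Suc (prod_encode (x n, 0)))) \<Longrightarrow>
    evals p n (if self_covering_code (c n) (d n) (x n) then 1 else 0)"
    by blast
  have "evals p n (if non_terminating S then 1 else 0)"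
    if S: "branch_wsts S" and n: "effective_description S n" for S :: "('x, 'a) olts" and n
  proof -
    from n obtain enc ord_prog post_prog ts where
      eff: "inj_on enc (states S)" "decides_rel enc (states S) (qorder S) ord_prog"
        "computes_Post enc S post_prog"
      and n: "n = prod_encode (prog_code ord_prog,
        prod_encode (ts, prod_encode (prog_code post_prog, enc (initial S))))"
      unfolding effective_description_def by blast
    interpret effective_olts S enc ord_prog post_prog
      using S eff by unfold_locales (simp_all add: branch_wsts_def)
    have n': "c n = prog_code post_prog" "d n = prog_code ord_prog" "x n = enc (initial S)"
      by (simp_all add: n c_def d_def x_def)
    have "self_covering_code (c n) (d n) (x n) \<longleftrightarrow> non_terminating S"
      using self_covering_code_iff S unfolding n' branch_wsts_def by blast
    moreover have "terminating_code (c n) (Suc (prod_encode (x n, 0))) \<longleftrightarrow> \<not> non_terminating S"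
      using terminating_code_iff unfolding n' by simp
    ultimately show ?thesis using p[of n] by simp
  qed
  then show ?thesis unfolding uniformly_decidable_def by blast
qed

end
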